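(* There exist a compact connected metric space $X$ without isolated points (not locally connected), an expansive homeomorphism $f:X\to X$, a metric $d$ on $X$ defining its topology and numbers $k>1$, $\varepsilon_0>0$ such that $f$ and $f^{-1}$ are Lipschitz for $d$ and $$\max\{d(f(x),f(y)),\,d(f^{-1}(x),f^{-1}(y))\}\ \geq\ \min\{k\,d(x,y),\varepsilon_0\}\qquad\text{for all }x,y\in X,$$ and a point $x\in X$ for which it is not true that both $\Lambda^+(x)\geq\log k$ and $\lambda^+(x)\leq-\log k$, where $\Lambda^+(x)$ and $\lambda^+(x)$ are the Lyapunov exponents of $f$ at $x$ with respect to $d$.
   Context: A homeomorphism $f:X\to X$ of a compact metric space $(X,\mathrm{dist})$ is expansive if there is $\alpha>0$ such that for all $x\neq y$ in $X$ there is $n\in\mathbb{Z}$ with $\mathrm{dist}(f^n(x),f^n(y))>\alpha$ (this property does not depend on the compatible metric chosen). It is a known theorem (Fathi) that for every expansive homeomorphism $f$ of a compact metric space there exist a compatible metric $d$ and numbers $k>1$, $\varepsilon_0>0$ such that $f$ and $f^{-1}$ are Lipschitz for $d$ and the displayed inequality holds. Lyapunov exponents with respect to $d$: for $x\in X$, $\delta>0$ and $n\geq 1$ put $$B^*_x(\delta,n)=\{y\in X\setminus\{x\} : d(f^j(x),f^j(y))\leq\delta \text{ for } j=0,1,\dots,n\},$$ $$A_\delta(x,n)=\sup_{y\in B^*_x(\delta,n)}\frac{d(f^n(x),f^n(y))}{d(x,y)},\qquad a_\delta(x,n)=\inf_{y\in B^*_x(\delta,n)}\frac{d(f^n(x),f^n(y))}{d(x,y)}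 .$$ Define $$\Lambda^+_\delta(x)=\limsup_{n\to+\infty}\tfrac1n\log A_\delta(x,n),\qquad \lambda^+_\delta(x)=\limsup_{n\to+\infty}\tfrac1n\log a_\delta(x,n),$$ and $\Lambda^+(x)=\lim_{\delta\to0}\Lambda^+_\delta(x)$, $\lambda^+(x)=\lim_{\delta\to0}\lambda^+_\delta(x)$ (limits as $\delta\to 0^+$, which exist by monotonicity in $\delta$). *)

theory Defs
  imports "HOL-Analysis.Analysis"
begin

text \<open>
  Everything is relative to a carrier set \<open>X\<close>; a homeomorphism of \<open>X\<close> is a function on the
  ambient type whose values matter only on \<open>X\<close>, with inverse \<open>inv_into X f\<close>.
\<close>

definition int_iterate :: "'a set \<Rightarrow> ('a \<Rightarrow> 'a) \<Rightarrow> int \<Rightarrow> 'a \<Rightarrow> 'a" where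
  "int_iterate X f n = (if 0 \<le> n then f ^^ nat n else inv_into X f ^^ nat (- n))"

definition expansive_homeomorphism ::
    "'a set \<Rightarrow> ('a \<Rightarrow> 'a \<Rightarrow> real) \<Rightarrow> ('a \<Rightarrow> 'a) \<Rightarrow> bool" where
  "expansive_homeomorphism X d f \<longleftrightarrow>
     homeomorphic_map (Metric_space.mtopology X d) (Metric_space.mtopology X d) f \<and>
     (\<exists>\<alpha>>0. \<forall>x\<in>X. \<forall>y\<in>X. x \<noteq> y \<longrightarrow>
        (\<exists>n. d (int_iterate X f n x) (int_iterate X f n y) > \<alpha>))"

definition punctured_dyn_ball ::
    "'a set \<Rightarrow> ('a \<Rightarrow> 'a \<Rightarrow> real) \<Rightarrow> ('a \<Rightarrow> 'a) \<Rightarrow> real \<Rightarrow> 'a \<Rightarrow> nat \<Rightarrow> 'a set" where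
  "punctured_dyn_ball X d f \<delta> x n =
     {y \<in> X - {x}. \<forall>j\<le>n. d ((f ^^ j) x) ((f ^^ j) y) \<le> \<delta>}"

text \<open>
  The supremum, infimum and logarithm below are real-valued. If \<open>X\<close> has no isolated points and
  \<open>f\<close> is a homeomorphism of \<open>X\<close> that is Lipschitz with Lipschitz inverse, then for \<open>\<delta> > 0\<close> the
  punctured dynamical ball is nonempty and the quotients lie between two positive constants
  depending on \<open>n\<close>, so these are the usual supremum and infimum and both are positive.
\<close>

definition max_expansion ::
    "'a set \<Rightarrow> ('a \<Rightarrow> 'a \<Rightarrow> real) \<Rightarrow> ('a \<Rightarrow> 'a) \<Rightarrow> real \<Rightarrow> 'a \<Rightarrow> nat \<Rightarrow> real" where
  "max_expansion X d f \<delta> x n =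
     (SUP y \<in> punctured_dyn_ball X d f \<delta> x n. d ((f ^^ n) x) ((f ^^ n) y) / d x y)"

definition min_expansion ::
    "'a set \<Rightarrow> ('a \<Rightarrow> 'a \<Rightarrow> real) \<Rightarrow> ('a \<Rightarrow> 'a) \<Rightarrow> real \<Rightarrow> 'a \<Rightarrow> nat \<Rightarrow> real" where
  "min_expansion X d f \<delta> x n =
     (INF y \<in> punctured_dyn_ball X d f \<delta> x n. d ((f ^^ n) x) ((f ^^ n) y) / d x y)"

definition upper_exponent_scale ::
    "'a set \<Rightarrow> ('a \<Rightarrow> 'a \<Rightarrow> real) \<Rightarrow> ('a \<Rightarrow> 'a) \<Rightarrow> real \<Rightarrow> 'a \<Rightarrow> ereal" where
  "upper_exponent_scale X d f \<delta> x =
     limsup (\<lambda>n. ereal (1 / real n * ln (max_expansion X d f \<delta> x n)))"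

definition lower_exponent_scale ::
    "'a set \<Rightarrow> ('a \<Rightarrow> 'a \<Rightarrow> real) \<Rightarrow> ('a \<Rightarrow> 'a) \<Rightarrow> real \<Rightarrow> 'a \<Rightarrow> ereal" where
  "lower_exponent_scale X d f \<delta> x =
     limsup (\<lambda>n. ereal (1 / real n * ln (min_expansion X d f \<delta> x n)))"

text \<open>
  The limits exist: as \<open>\<delta>\<close> decreases the balls shrink, so the upper exponent at scale \<open>\<delta>\<close>
  decreases and the lower one increases.
\<close>

definition upper_lyapunov_exponent ::
    "'a set \<Rightarrow> ('a \<Rightarrow> 'a \<Rightarrow> real) \<Rightarrow> ('a \<Rightarrow> 'a) \<Rightarrow> 'a \<Rightarrow> ereal" where
  "upper_lyapunov_exponent X d f x = Lim (at_right 0) (\<lambda>\<delta>. upper_exponent_scale X d f \<delta> x)"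

definition lower_lyapunov_exponent ::
    "'a set \<Rightarrow> ('a \<Rightarrow> 'a \<Rightarrow> real) \<Rightarrow> ('a \<Rightarrow> 'a) \<Rightarrow> 'a \<Rightarrow> ereal" where
  "lower_lyapunov_exponent X d f x = Lim (at_right 0) (\<lambda>\<delta>. lower_exponent_scale X d f \<delta> x)"

end

theory Submission
  imports Defs
begin

text \<open>
  The lollipop is the segment \<open>[0, 2]\<close> with 1 and 2 identified: a stem \<open>[0, 1]\<close> with a circle of
  length 1 attached at its end. Doubling, wrapped around the circle, is a self-map of it, and \<open>X\<close> is
  the inverse limit of this map: a dyadic solenoid together with a ray winding onto it, so \<open>X\<close> is
  connected but not locally connected along the solenoid. Let \<open>f\<close> be the shift that forgets the
  present coordinate, and let \<open>d x y\<close> be the supremum of the distances of the \<open>n\<close>-th coordinates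
  divided by \<open>2 ^ n\<close>. Doubling folds the lollipop near the vertex, but points with close preimages
  lie on a common piece of the half line, where doubling expands; hence \<open>f\<close> is hyperbolic with
  constant 2. Around the fixed end point of the ray every point is contracted by exactly \<open>1 / 2\<close>
  at each step, so the upper exponent there is \<open>- ln 2\<close>.
\<close>

section \<open>Sequences in a bounded metric space\<close>

definition seq_dist :: "('a \<Rightarrow> 'a \<Rightarrow> real) \<Rightarrow> (nat \<Rightarrow> 'a) \<Rightarrow> (nat \<Rightarrow> 'a) \<Rightarrow> real" where
  "seq_dist d x y = (SUP n. d (x n) (y n) / 2 ^ n)"

locale bounded_metric = Metric_space M d for M :: "'a set" and d +
  fixes B :: real
  assumes dist_le_bound: "d x y \<le> B"
begin

lemma bound_nonneg: "0 \<le> B"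
  using nonneg dist_le_bound order_trans by blast

lemma scaled_dist_le: "d a b / 2 ^ n \<le> B / 2 ^ m" if "m \<le> n"
  using that dist_le_bound[of a b] bound_nonneg
  by (intro frac_le) (auto intro: power_increasing)

lemma dist_le_seq_dist: "d (x n) (y n) / 2 ^ n \<le> seq_dist d x y"
  unfolding seq_dist_def
  using scaled_dist_le[of 0]
  by (intro cSUP_upper) (auto intro!: bdd_aboveI)

lemma seq_dist_le: "seq_dist d x y \<le> C" if "\<And>n. d (x n) (y n) / 2 ^ n \<le> C"
  unfolding seq_dist_def by (intro cSUP_least) (auto simp: that)

lemma seq_dist_lt_imp: "d (x n) (y n) < 2 ^ n * \<epsilon>" if "seq_dist d x y < \<epsilon>"
proof -
  have "d (x n) (y n) / 2 ^ n < \<epsilon>"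
    using dist_le_seq_dist that by (rule le_less_trans)
  then show ?thesis by (simp add: field_simps)
qed

text \<open>The weights push every coordinate beyond \<open>N\<close> below
  \<open>B / 2 ^ N\<close>, so closeness is decided by finitely many coordinates.\<close>

lemma seq_dist_le_if_agree:
  assumes "\<And>n. n \<le> N \<Longrightarrow> d (x n) (y n) \<le> \<epsilon>" "0 \<le> \<epsilon>" "B / 2 ^ N \<le> \<epsilon>"
  shows "seq_dist d x y \<le> \<epsilon>"
proof (rule seq_dist_le)
  fix n
  show "d (x n) (y n) / 2 ^ n \<le> \<epsilon>"
  proof (cases "n \<le> N")
    case True
    have "d (x n) (y n) / 2 ^ n \<le> d (x n) (y n) / 1"
      by (intro divide_left_mono) auto
    then show ?thesis using assms(1)[OF True] by simp
  next
    case False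
    then show ?thesis
      using scaled_dist_le[of N n] assms(3) by (meson nat_le_linear order_trans)
  qed
qed

lemma bound_scaled_small:
  assumes "0 < \<epsilon>" obtains N where "B / 2 ^ N \<le> \<epsilon>"
proof -
  obtain N where "B / \<epsilon> < 2 ^ N" using real_arch_pow[of 2 "B / \<epsilon>"] by auto
  then show ?thesis using assms by (intro that[of N]) (simp add: field_simps)
qed

lemma Metric_space_seq_dist:
  assumes "\<And>x n. x \<in> X \<Longrightarrow> x n \<in> M"
  shows "Metric_space X (seq_dist d)"
proof
  show nonneg': "0 \<le> seq_dist d x y" for x y
    using dist_le_seq_dist[of x 0 y] nonneg[of "x 0" "y 0"] by (simp del: nonneg)
  show "seq_dist d x y = seq_dist d y x" for x y
    by (simp add: seq_dist_def commute)
  show "seq_dist d x y = 0 \<longleftrightarrow> x = y" if "x \<in> X" "y \<in> X" for x y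
  proof
    assume "seq_dist d x y = 0"
    then have "d (x n) (y n) / 2 ^ n \<le> 0" for n
      by (metis dist_le_seq_dist)
    then have "d (x n) (y n) = 0" for n
      using nonneg[of "x n" "y n"] by (metis divide_le_0_iff order_antisym_conv zero_less_numeral
          zero_less_power not_less)
    then show "x = y" using assms that by (auto intro!: ext)
  next
    assume "x = y"
    then show "seq_dist d x y = 0"
      using assms that nonneg' by (intro antisym seq_dist_le) auto
  qed
  show "seq_dist d x z \<le> seq_dist d x y + seq_dist d y z"
    if "x \<in> X" "y \<in> X" "z \<in> X" for x y z
  proof (rule seq_dist_le)
    fix n
    have "d (x n) (z n) / 2 ^ n \<le> (d (x n) (y n) + d (y n) (z n)) / 2 ^ n"
      using assms that by (intro divide_right_mono triangle) auto
    also have "\<dots> \<le> seq_dist d x y + seq_dist d y z"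
      unfolding add_divide_distrib by (intro add_mono dist_le_seq_dist)
    finally show "d (x n) (z n) / 2 ^ n \<le> seq_dist d x y + seq_dist d y z" .
  qed
qed

text \<open>By Tychonoff the full product is compact, hence so is its closed subset
  \<open>X\<close>. The identity from the product topology to the weighted supremum metric is
  continuous, and it carries compactness over.\<close>

lemma compact_space_seq_dist:
  assumes X: "\<And>x n. x \<in> X \<Longrightarrow> x n \<in> M"
    and "compact_space mtopology"
    and closed: "closedin (product_topology (\<lambda>_. mtopology) UNIV) X"
  shows "compact_space (Metric_space.mtopology X (seq_dist d))"
proof -
  interpret S: Metric_space X "seq_dist d" using X by (rule Metric_space_seq_dist)
  let ?P = "product_topology (\<lambda>_::nat. mtopology) UNIV"
  have "continuous_map (subtopology ?P X) S.mtopology id"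
    unfolding S.continuous_map_to_metric
  proof (intro ballI allI impI)
    fix x and \<epsilon> :: real
    assume "x \<in> topspace (subtopology ?P X)" and \<epsilon>: "\<epsilon> > 0"
    then have x: "x \<in> X" by simp
    obtain N where N: "B / 2 ^ N \<le> \<epsilon> / 2" using bound_scaled_small \<epsilon> half_gt_zero by metis
    \<comment> \<open>This basic open set constrains only the coordinates up to \<open>N\<close>;
      the weights take care of the others.\<close>
    let ?W = "\<lambda>n. if n \<le> N then mball (x n) (\<epsilon> / 2) else M"
    let ?U = "PiE UNIV ?W"
    have "openin ?P ?U"
    proof (rule product_topology_basis)
      show "openin mtopology (?W n)" for n
        using openin_topspace[of mtopology] by auto
      show "finite {n. ?W n \<noteq> topspace mtopology}"
        by (rule finite_subset[of _ "{..N}"]) auto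
    qed
    then have "openin (subtopology ?P X) (?U \<inter> X)" by (simp add: openin_subtopology_Int)
    moreover have "x \<in> ?U \<inter> X" using x X \<epsilon> by (auto simp: PiE_iff)
    moreover have "id y \<in> S.mball (id x) \<epsilon>" if "y \<in> ?U \<inter> X" for y
    proof -
      have "d (x n) (y n) \<le> \<epsilon> / 2" if "n \<le> N" for n
        using \<open>y \<in> _\<close> that by (auto simp: PiE_iff dest!: spec[of _ n])
      then have "seq_dist d x y \<le> \<epsilon> / 2"
        using N \<epsilon> by (intro seq_dist_le_if_agree) auto
      then show ?thesis using that x \<epsilon> by simp
    qed
    ultimately show "\<exists>U. openin (subtopology ?P X) U \<and> x \<in> U \<and>
        (\<forall>y\<in>U. id y \<in> S.mball (id x) \<epsilon>)"
      by blast
  qed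
  moreover have "compactin (subtopology ?P X) X"
    using assms(2) closed
    by (simp add: closedin_compact_space compact_space_product_topology compactin_subtopology)
  ultimately have "compactin S.mtopology (id ` X)" by (rule image_compactin[rotated])
  then show ?thesis by (simp add: compact_space_def)
qed

end

section \<open>The lollipop\<close>

text \<open>
  The cap 2 never matters on the carrier \<open>{0..<2}\<close>; it keeps the supremum in \<^const>\<open>seq_dist\<close>
  finite off the carrier, where a metric space must still have a nonnegative distance.
\<close>

definition ldist :: "real \<Rightarrow> real \<Rightarrow> real" where
  "ldist s t = min 2 (min \<bar>s - t\<bar> (min (\<bar>s - 1\<bar> + \<bar>t - 2\<bar>) (\<bar>s - 2\<bar> + \<bar>t - 1\<bar>)))"

text \<open>The projection of the half line onto the lollipop: the stem stays, and all beyond it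
  winds around the circle with period 1.\<close>

definition wrap :: "real \<Rightarrow> real" where
  "wrap t = (if t < 1 then t else 1 + frac t)"

definition double :: "real \<Rightarrow> real" where
  "double t = wrap (2 * t)"

lemma ldist_le:
  "ldist s t \<le> 2" "ldist s t \<le> \<bar>s - t\<bar>"
  "ldist s t \<le> \<bar>s - 1\<bar> + \<bar>t - 2\<bar>" "ldist s t \<le> \<bar>s - 2\<bar> + \<bar>t - 1\<bar>"
  unfolding ldist_def by (meson min.cobounded1 min.cobounded2 order_trans)+

lemma ldist_cases:
  obtains "ldist s t = 2" | "ldist s t = \<bar>s - t\<bar>" | "ldist s t = \<bar>s - 1\<bar> + \<bar>t - 2\<bar>"
    | "ldist s t = \<bar>s - 2\<bar> + \<bar>t - 1\<bar>"
  unfolding ldist_def min_def by metis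

lemma ldist_eqI:
  assumes "c \<le> 2" "c \<le> \<bar>s - t\<bar>" "c \<le> \<bar>s - 1\<bar> + \<bar>t - 2\<bar>" "c \<le> \<bar>s - 2\<bar> + \<bar>t - 1\<bar>"
    and "c = \<bar>s - t\<bar> \<or> c = \<bar>s - 1\<bar> + \<bar>t - 2\<bar> \<or> c = \<bar>s - 2\<bar> + \<bar>t - 1\<bar>"
  shows "ldist s t = c"
proof (rule antisym)
  show "ldist s t \<le> c" using assms(5) ldist_le[of s t] by (elim disjE) simp_all
  show "c \<le> ldist s t" unfolding ldist_def by (intro min.boundedI assms)
qed

lemma ldist_nonneg: "0 \<le> ldist s t"
  by (simp add: ldist_def)

lemma ldist_commute: "ldist s t = ldist t s"
  by (auto simp: ldist_def abs_minus_commute min.commute add.commute)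

text \<open>Two routes through the identified point compose to a direct route or to a single such
  route, and the cap 2 bounds everything, so each pair of cases is linear arithmetic.\<close>

lemma ldist_triangle: "ldist s u \<le> ldist s t + ldist t u"
proof (cases s t rule: ldist_cases)
  case 1
  then show ?thesis using ldist_le[of s u] ldist_nonneg[of t u] by linarith
next
  case 2
  then show ?thesis
    using ldist_le[of s u] ldist_nonneg[of s t] by (cases t u rule: ldist_cases) linarith+
next
  case 3
  then show ?thesis
    using ldist_le[of s u] ldist_nonneg[of s t] by (cases t u rule: ldist_cases) linarith+
next
  case 4
  then show ?thesis
    using ldist_le[of s u] ldist_nonneg[of s t] by (cases t u rule: ldist_cases) linarith+
qed

interpretation lollipop: bounded_metric "{0..<2}" ldist 2
proof
  show "ldist s t = 0 \<longleftrightarrow> s = t" if "s \<in> {0..<2}" "t \<in> {0..<2}" for s t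
    using that unfolding ldist_def by auto
qed (simp_all add: ldist_nonneg ldist_commute ldist_triangle, simp add: ldist_def)

section \<open>Wrapping the half line around the lollipop\<close>

lemma wrap_id: "0 \<le> t \<Longrightarrow> t < 2 \<Longrightarrow> wrap t = t"
  by (auto simp: wrap_def frac_def floor_eq_iff[of _ 1] intro: floor_unique)

lemma wrap_in: "0 \<le> t \<Longrightarrow> wrap t \<in> {0..<2}"
  by (auto simp: wrap_def frac_lt_1)

lemma wrap_add_int: "1 \<le> t \<Longrightarrow> wrap (t + of_nat n) = wrap t"
  by (simp add: wrap_def frac_def)

text \<open>On the circle part \<open>wrap\<close> removes whole turns, and twice a whole number of
  turns is again removed. This makes \<open>wrap\<close> a semiconjugacy from multiplication by 2 to
  \<open>double\<close>.\<close>

lemma wrap_2_wrap: "wrap (2 * wrap t) = wrap (2 * t)" if "0 \<le> t"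
proof (cases "t < 1")
  case False
  then have "1 \<le> wrap t" by (simp add: wrap_def)
  have "2 * t = 2 * wrap t + of_nat (nat (2 * (\<lfloor>t\<rfloor> - 1)))"
    using False by (simp add: wrap_def frac_def)
  also have "wrap \<dots> = wrap (2 * wrap t)"
    using \<open>1 \<le> wrap t\<close> by (intro wrap_add_int) simp
  finally show ?thesis ..
qed (auto simp: wrap_def)

text \<open>The circle has length 1, so for arcs of length at most 1/2 the way around the other side
  is no shorter: \<open>wrap\<close> is isometric at this scale.\<close>

lemma ldist_wrap:
  assumes "0 \<le> a" "a \<le> b" "b \<le> a + 1 / 2"
  shows "ldist (wrap a) (wrap b) = b - a"
proof (cases "b < 2")
  case True
  then show ?thesis using assms by (simp add: wrap_id) (intro ldist_eqI; auto)
next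
  case False
  then have ab: "1 \<le> a" "1 \<le> b" using assms by auto
  have "\<lfloor>b\<rfloor> = \<lfloor>a\<rfloor> \<or> \<lfloor>b\<rfloor> = \<lfloor>a\<rfloor> + 1" using assms by linarith
  then show ?thesis
  proof
    assume "\<lfloor>b\<rfloor> = \<lfloor>a\<rfloor>"
    then have "wrap b = wrap a + (b - a)" using ab by (simp add: wrap_def frac_def)
    moreover have "1 \<le> wrap a" "wrap b < 2" using ab by (auto simp: wrap_def frac_lt_1)
    ultimately show ?thesis using assms by (intro ldist_eqI) auto
  \<comment> \<open>Here the arc passes the vertex, and the route through the identification of 1
    and 2 realises the distance.\<close>
  next
    assume "\<lfloor>b\<rfloor> = \<lfloor>a\<rfloor> + 1"
    then have "wrap b = wrap a + (b - a) - 1" using ab by (simp add: wrap_def frac_def)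
    moreover have "wrap a < 2" "1 \<le> wrap b" using ab by (auto simp: wrap_def frac_lt_1)
    ultimately show ?thesis using assms by (intro ldist_eqI) auto
  qed
qed

lemma ldist_wrap_eq: "ldist (wrap a) (wrap b) = \<bar>a - b\<bar>"
  if "0 \<le> a" "0 \<le> b" "\<bar>a - b\<bar> \<le> 1 / 2"
  using that ldist_wrap[of a b] ldist_wrap[of b a] ldist_commute[of "wrap a" "wrap b"] by (cases "a \<le> b") auto

text \<open>Any two points of the circle are at most 1/2 apart, so long arcs in the circle are
  harmless; an arc from the stem into the second turn or beyond is split at the vertex 1.\<close>

lemma ldist_wrap_le: "ldist (wrap a) (wrap b) \<le> \<bar>a - b\<bar>" if "0 \<le> a" "0 \<le> b"
proof -
  have ord: "ldist (wrap a) (wrap b) \<le> b - a" if "0 \<le> a" "a \<le> b" for a b :: real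
  proof -
    have circle: "ldist s t \<le> 1 / 2" if "s \<in> {1..<2}" "t \<in> {1..<2}" for s t
      using that ldist_le[of s t] by auto
    consider "b < 2" | "1 \<le> a" | "a < 1" "2 \<le> b" by linarith
    then show ?thesis
    proof cases
      case 1
      then show ?thesis using that ldist_le(2)[of a b] by (simp add: wrap_id)
    next
      case 2
      then have "ldist (wrap a) (wrap b) \<le> 1 / 2"
        using that by (intro circle) (auto simp: wrap_def frac_lt_1)
      then show ?thesis using ldist_wrap[of a b] that by linarith
    next
      case 3
      have "ldist (wrap a) (wrap b) \<le> ldist (wrap a) 1 + ldist 1 (wrap b)"
        by (rule ldist_triangle)
      also have "\<dots> \<le> (1 - a) + 1 / 2"
        using 3 that by (intro add_mono circle) (auto simp: wrap_def frac_lt_1 ldist_def)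
      finally show ?thesis using 3 by linarith
    qed
  qed
  then show ?thesis
    using that ord[of a b] ord[of b a] ldist_commute[of "wrap a" "wrap b"] by (cases "a \<le> b") auto
qed

section \<open>Doubling on the lollipop\<close>

lemma abs_diff_2: "\<bar>2 * s - 2 * t\<bar> = 2 * \<bar>s - t\<bar>" for s t :: real
  by (simp add: abs_if)

lemma double_in: "0 \<le> t \<Longrightarrow> double t \<in> {0..<2}"
  unfolding double_def by (rule wrap_in) simp

lemma double_wrap: "0 \<le> t \<Longrightarrow> double (wrap t) = wrap (2 * t)"
  by (simp add: double_def wrap_2_wrap)

text \<open>
  The identification of 1 with 2 lets one of the two points be moved one turn ahead, so that
  close points have images which lift to close points of the half line.
\<close>

lemma ldist_lift:
  assumes "0 \<le> s" "0 \<le> t" "ldist s t < 1 / 8"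
  obtains a b where "0 \<le> a" "0 \<le> b" "\<bar>a - b\<bar> \<le> 2 * ldist s t"
    "double s = wrap a" "double t = wrap b"
proof (cases s t rule: ldist_cases)
  case 1
  then show ?thesis using assms by simp
next
  case 2
  then show ?thesis
    using assms by (intro that[of "2 * s" "2 * t"]) (auto simp: double_def abs_diff_2)
next
  case 3
  then have "1 \<le> 2 * s" using assms(3) by linarith
  then have "wrap (2 * s + 2) = double s"
    using wrap_add_int[of "2 * s" 2] by (simp add: double_def)
  moreover have "\<bar>(2 * s + 2) - 2 * t\<bar> \<le> 2 * ldist s t"
    using 3 abs_diff_2[of "s - 1" "t - 2"] abs_triangle_ineq4[of "s - 1" "t - 2"]
    by (simp add: algebra_simps)
  ultimately show ?thesis
    using assms by (intro that[of "2 * s + 2" "2 * t"]) (auto simp: double_def)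
next
  case 4
  then have "1 \<le> 2 * t" using assms(3) by linarith
  then have "wrap (2 * t + 2) = double t"
    using wrap_add_int[of "2 * t" 2] by (simp add: double_def)
  moreover have "\<bar>2 * s - (2 * t + 2)\<bar> \<le> 2 * ldist s t"
    using 4 abs_diff_2[of "s - 2" "t - 1"] abs_triangle_ineq4[of "s - 2" "t - 1"]
    by (simp add: algebra_simps)
  ultimately show ?thesis
    using assms by (intro that[of "2 * s" "2 * t + 2"]) (auto simp: double_def)
qed

lemma double_lipschitz: "ldist (double s) (double t) \<le> 2 * ldist s t"
  if st: "s \<in> {0..<2}" "t \<in> {0..<2}"
proof -
  have le: "ldist (double s) (double t) \<le> 2 * \<bar>s - t\<bar>" if "0 \<le> s" "0 \<le> t" for s t
    unfolding double_def abs_diff_2[symmetric] using that by (intro ldist_wrap_le) auto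
  \<comment> \<open>The ends of the identified pair have the same image, so the two legs of a route
    through it can be estimated separately.\<close>
  have "double 1 = double 2" by (simp add: double_def wrap_def frac_def)
  then have turn: "ldist (double s) (double t) \<le> 2 * (\<bar>s - 1\<bar> + \<bar>t - 2\<bar>)"
    if "0 \<le> s" "0 \<le> t" for s t
    using le[of s 1] le[of t 2] that ldist_triangle[of "double s" "double t" "double 1"]
      ldist_commute[of "double t" "double 2"] by (simp add: distrib_left)
  show ?thesis
  proof (cases s t rule: ldist_cases)
    case 1
    then show ?thesis using st ldist_le(2)[of s t] by auto
  next
    case 2
    then show ?thesis using le[of s t] st by simp
  next
    case 3
    then show ?thesis using turn[of s t] st by simp
  next
    case 4
    then show ?thesis using turn[of t s] st ldist_commute[of "double s"] by simp
  qed
qed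

text \<open>Preimages less than 1/8 apart have images that lift to points less than 1/4 apart, and
  doubling these keeps them within the scale 1/2 where \<open>wrap\<close> is isometric, so the
  distance doubles exactly. Otherwise the preimages themselves supply the bound 1/8.\<close>

lemma double_hyperbolic:
  assumes "0 \<le> s" "0 \<le> t"
  shows "min (2 * ldist (double s) (double t)) (1 / 8)
    \<le> max (ldist (double (double s)) (double (double t))) (ldist s t)"
proof (cases "ldist s t < 1 / 8")
  case True
  with assms obtain a b where ab: "0 \<le> a" "0 \<le> b" "\<bar>a - b\<bar> \<le> 2 * ldist s t"
    "double s = wrap a" "double t = wrap b"
    by (rule ldist_lift)
  then have "ldist (double s) (double t) = \<bar>a - b\<bar>"
    using True by (simp add: ldist_wrap_eq)
  moreover have "ldist (double (double s)) (double (double t)) = \<bar>2 * a - 2 * b\<bar>"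
    using ab True by (simp add: double_wrap) (intro ldist_wrap_eq; linarith)
  ultimately show ?thesis by (simp add: abs_diff_2)
qed auto

lemma compact_space_lollipop: "compact_space lollipop.mtopology"
proof -
  have "continuous_map (top_of_set {0..2}) lollipop.mtopology wrap"
    unfolding lollipop.continuous_map_to_metric
  proof (intro ballI allI impI)
    fix a \<epsilon> :: real
    assume "a \<in> topspace (top_of_set {0..2})" and \<epsilon>: "\<epsilon> > 0"
    then have a: "0 \<le> a" "a \<le> 2" by auto
    have "wrap b \<in> lollipop.mball (wrap a) \<epsilon>" if "b \<in> ball a \<epsilon> \<inter> {0..2}" for b
      using ldist_wrap_le[of a b] wrap_in a that by (auto simp: dist_real_def)
    then show "\<exists>U. openin (top_of_set {0..2}) U \<and> a \<in> U \<and>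
        (\<forall>b\<in>U. wrap b \<in> lollipop.mball (wrap a) \<epsilon>)"
      using a \<epsilon> by (intro exI[of _ "ball a \<epsilon> \<inter> {0..2}"]) (auto simp: openin_open)
  qed
  moreover have "compactin (top_of_set {0..2::real}) {0..2}"
    by (simp add: compactin_subtopology)
  ultimately have "compactin lollipop.mtopology (wrap ` {0..2})" by (rule image_compactin[rotated])
  moreover have "wrap ` {0..2} = {0..<2}"
  proof
    show "{0..<2} \<subseteq> wrap ` {0..2}" using wrap_id by (force simp: image_iff)
    show "wrap ` {0..2} \<subseteq> {0..<2}" by (intro image_subsetI wrap_in) simp
  qed
  ultimately show ?thesis by (simp add: compact_space_def)
qed

lemma continuous_map_double: "continuous_map lollipop.mtopology lollipop.mtopology double"
proof -
  have "Lipschitz_continuous_map (metric ({0..<2}, ldist)) (metric ({0..<2}, ldist)) double"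
    unfolding Lipschitz_continuous_map_def
    using double_lipschitz double_in by (auto intro!: exI[of _ 2])
  then show ?thesis
    using Lipschitz_continuous_imp_continuous_map by (fastforce simp: mtopology_of_def)
qed

section \<open>The inverse limit of the doubling map\<close>

definition lollipop_limit :: "(nat \<Rightarrow> real) set" where
  "lollipop_limit = {x. \<forall>n. x n \<in> {0..<2} \<and> double (x (Suc n)) = x n}"

definition shift :: "(nat \<Rightarrow> 'a) \<Rightarrow> nat \<Rightarrow> 'a" where
  "shift x = (\<lambda>n. x (Suc n))"

text \<open>The natural extension of \<open>double\<close>. Its inverse \<open>shift\<close> passes
  to preimages, which is why forward iteration contracts along the ray.\<close>

definition unshift :: "(nat \<Rightarrow> real) \<Rightarrow> nat \<Rightarrow> real" where
  "unshift x = case_nat (double (x 0)) x"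

text \<open>Halving is a continuous choice of preimages on the half line, so \<open>wrap\<close>
  lifts to a path in the inverse limit, starting at the fixed point with all coordinates 0.\<close>

definition ray :: "real \<Rightarrow> nat \<Rightarrow> real" where
  "ray t = (\<lambda>n. wrap (t / 2 ^ n))"

lemma lollipop_limit_in: "x \<in> lollipop_limit \<Longrightarrow> x n \<in> {0..<2}"
  by (simp add: lollipop_limit_def)

lemma lollipop_limit_double: "x \<in> lollipop_limit \<Longrightarrow> double (x (Suc n)) = x n"
  by (simp add: lollipop_limit_def)

interpretation limit: Metric_space lollipop_limit "seq_dist ldist"
  by (rule lollipop.Metric_space_seq_dist) (rule lollipop_limit_in)

lemma shift_in: "x \<in> lollipop_limit \<Longrightarrow> shift x \<in> lollipop_limit"
  by (simp add: lollipop_limit_def shift_def)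

lemma unshift_in: "x \<in> lollipop_limit \<Longrightarrow> unshift x \<in> lollipop_limit"
  using double_in[of "x 0"] by (auto simp: lollipop_limit_def unshift_def split: nat.split)

lemma shift_unshift [simp]: "shift (unshift x) = x"
  by (simp add: shift_def unshift_def)

lemma unshift_shift: "x \<in> lollipop_limit \<Longrightarrow> unshift (shift x) = x"
  by (auto simp: shift_def unshift_def lollipop_limit_double split: nat.split)

lemma inv_into_shift: "x \<in> lollipop_limit \<Longrightarrow> inv_into lollipop_limit shift x = unshift x"
  by (metis inj_on_inverseI inv_into_f_f shift_unshift unshift_in unshift_shift)

lemma shift_funpow: "(shift ^^ j) x = (\<lambda>n. x (n + j))"
  by (induction j) (simp_all add: shift_def)

lemma ray_in: "0 \<le> t \<Longrightarrow> ray t \<in> lollipop_limit"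
proof -
  assume "0 \<le> t"
  then have "wrap (t / 2 ^ n) \<in> {0..<2}" for n by (intro wrap_in) simp
  moreover have "double (wrap (t / 2 ^ Suc n)) = wrap (t / 2 ^ n)" for n
    using \<open>0 \<le> t\<close> by (subst double_wrap) auto
  ultimately show ?thesis by (simp add: lollipop_limit_def ray_def)
qed

lemma seq_dist_shift_le: "seq_dist ldist (shift x) (shift y) \<le> 2 * seq_dist ldist x y"
proof (rule lollipop.seq_dist_le)
  fix n
  show "ldist (shift x n) (shift y n) / 2 ^ n \<le> 2 * seq_dist ldist x y"
    using lollipop.dist_le_seq_dist[of x "Suc n" y] by (simp add: shift_def)
qed

lemma seq_dist_unshift_le:
  assumes "x \<in> lollipop_limit" "y \<in> lollipop_limit"
  shows "seq_dist ldist (unshift x) (unshift y) \<le> 2 * seq_dist ldist x y"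
proof (rule lollipop.seq_dist_le)
  fix n
  show "ldist (unshift x n) (unshift y n) / 2 ^ n \<le> 2 * seq_dist ldist x y"
  proof (cases n)
    case 0
    have "ldist (double (x 0)) (double (y 0)) \<le> 2 * ldist (x 0) (y 0)"
      using assms by (intro double_lipschitz lollipop_limit_in)
    then show ?thesis
      using 0 lollipop.dist_le_seq_dist[of x 0 y] by (simp add: unshift_def)
  next
    case (Suc m)
    then show ?thesis
      using lollipop.dist_le_seq_dist[of x m y] limit.nonneg[of x y]
      by (simp add: unshift_def del: limit.nonneg)
  qed
qed

text \<open>Either the first coordinate already realises the distance, in which case the hyperbolicity
  of the doubling map applies, or the distance is doubled by dropping that coordinate.\<close>

lemma seq_dist_hyperbolic:
  assumes "x \<in> lollipop_limit" "y \<in> lollipop_limit"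
  shows "min (2 * seq_dist ldist x y) (1 / 8)
    \<le> max (seq_dist ldist (shift x) (shift y)) (seq_dist ldist (unshift x) (unshift y))"
proof -
  let ?d0 = "ldist (x 0) (y 0)" and ?S = "seq_dist ldist (shift x) (shift y)"
    and ?U = "seq_dist ldist (unshift x) (unshift y)"
  have "seq_dist ldist x y \<le> max ?d0 (?S / 2)"
  proof (rule lollipop.seq_dist_le)
    fix n
    show "ldist (x n) (y n) / 2 ^ n \<le> max ?d0 (?S / 2)"
      using lollipop.dist_le_seq_dist[of "shift x" "n - 1" "shift y"]
      by (cases n) (auto simp: shift_def)
  qed
  moreover have "min (2 * ?d0) (1 / 8) \<le> max ?U ?S"
  proof -
    have "min (2 * ?d0) (1 / 8)
        \<le> max (ldist (double (x 0)) (double (y 0))) (ldist (x 1) (y 1))"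
      using double_hyperbolic[of "x 1" "y 1"] lollipop_limit_in[OF assms(1), of 1]
        lollipop_limit_in[OF assms(2), of 1] lollipop_limit_double[OF assms(1), of 0]
        lollipop_limit_double[OF assms(2), of 0] by simp
    also have "\<dots> \<le> max ?U ?S"
      using lollipop.dist_le_seq_dist[of "unshift x" 0 "unshift y"]
        lollipop.dist_le_seq_dist[of "shift x" 0 "shift y"]
      by (intro max.mono) (simp_all add: unshift_def shift_def)
    finally show ?thesis .
  qed
  ultimately show ?thesis by linarith
qed

section \<open>Compactness, density of the ray and connectedness\<close>

lemma compact_space_limit: "compact_space limit.mtopology"
proof (rule lollipop.compact_space_seq_dist[OF _ compact_space_lollipop])
  let ?P = "product_topology (\<lambda>_::nat. lollipop.mtopology) UNIV"
  have proj: "continuous_map ?P lollipop.mtopology (\<lambda>x. x n)" for n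
    using continuous_map_product_projection[of n UNIV "\<lambda>_. lollipop.mtopology"] by simp
  have "continuous_map ?P lollipop.mtopology (\<lambda>x. double (x (Suc n)))" for n
    using continuous_map_compose[OF proj[of "Suc n"] continuous_map_double] by (simp add: o_def)
  then have "closedin ?P {x \<in> topspace ?P. double (x (Suc n)) = x n}" for n
    by (intro closedin_continuous_maps_eq[OF lollipop.Hausdorff_space_mtopology] proj)
  then have "closedin ?P (\<Inter>n. {x \<in> topspace ?P. double (x (Suc n)) = x n})"
    by (intro closedin_INT) auto
  moreover have "(\<Inter>n. {x \<in> topspace ?P. double (x (Suc n)) = x n}) = lollipop_limit"
    by (auto simp: lollipop_limit_def PiE_iff)
  ultimately show "closedin ?P lollipop_limit" by simp
qed (rule lollipop_limit_in)

lemma seq_dist_ray_le: "seq_dist ldist (ray s) (ray t) \<le> \<bar>s - t\<bar>" if "0 \<le> s" "0 \<le> t"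
proof (rule lollipop.seq_dist_le)
  fix n
  have "ldist (ray s n) (ray t n) \<le> \<bar>s / 2 ^ n - t / 2 ^ n\<bar>"
    unfolding ray_def using that by (intro ldist_wrap_le) auto
  also have "\<dots> = \<bar>s - t\<bar> / 2 ^ n"
    by (simp add: diff_divide_distrib[symmetric])
  also have "\<dots> \<le> \<bar>s - t\<bar> / 1"
    by (intro divide_left_mono) auto
  finally have *: "ldist (ray s n) (ray t n) \<le> \<bar>s - t\<bar>" by simp
  have "ldist (ray s n) (ray t n) / 2 ^ n \<le> ldist (ray s n) (ray t n) / 1"
    by (intro divide_left_mono) (auto simp: ldist_nonneg)
  then show "ldist (ray s n) (ray t n) / 2 ^ n \<le> \<bar>s - t\<bar>" using * by simp
qed

text \<open>The parameter is chosen so that coordinate \<open>N\<close> is \<open>x N\<close>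
  itself; the earlier coordinates are then forced by doubling, whence the downward
  induction.\<close>

lemma ray_agrees:
  assumes x: "x \<in> lollipop_limit" and "n \<le> N"
  shows "ray (2 ^ N * x N) n = x n"
  using \<open>n \<le> N\<close>
proof (induction n rule: inc_induct)
  case base
  then show ?case using lollipop_limit_in[OF x, of N] by (simp add: ray_def wrap_id)
next
  case (step n)
  have "ray (2 ^ N * x N) \<in> lollipop_limit"
    using lollipop_limit_in[OF x, of N] by (intro ray_in) auto
  then show ?case using step x lollipop_limit_double by metis
qed

lemma ray_dense:
  assumes x: "x \<in> lollipop_limit" and "\<epsilon> > 0"
  obtains N where "seq_dist ldist x (ray (2 ^ N * x N)) \<le> \<epsilon>"
proof -
  obtain N where N: "2 / 2 ^ N \<le> \<epsilon>" using lollipop.bound_scaled_small \<open>\<epsilon> > 0\<close> by metis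
  have "ldist (x n) (ray (2 ^ N * x N) n) \<le> \<epsilon>" if "n \<le> N" for n
    using ray_agrees[OF x that] lollipop_limit_in[OF x, of n] \<open>\<epsilon> > 0\<close> by (simp add: ldist_def)
  then have "seq_dist ldist x (ray (2 ^ N * x N)) \<le> \<epsilon>"
    using N \<open>\<epsilon> > 0\<close> by (intro lollipop.seq_dist_le_if_agree) auto
  then show ?thesis by (rule that)
qed

text \<open>The space is the closure of the ray, a continuous image of the half line.\<close>

lemma connected_space_limit: "connected_space limit.mtopology"
proof -
  have "continuous_map (top_of_set {0..}) limit.mtopology ray"
    unfolding limit.continuous_map_to_metric
  proof (intro ballI allI impI)
    fix s \<epsilon> :: real
    assume "s \<in> topspace (top_of_set {0..})" and \<epsilon>: "\<epsilon> > 0"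
    then have s: "0 \<le> s" by simp
    have "ray t \<in> limit.mball (ray s) \<epsilon>" if "t \<in> ball s \<epsilon> \<inter> {0..}" for t
      using seq_dist_ray_le[of s t] ray_in s that by (auto simp: dist_real_def)
    then show "\<exists>U. openin (top_of_set {0..}) U \<and> s \<in> U \<and>
        (\<forall>t\<in>U. ray t \<in> limit.mball (ray s) \<epsilon>)"
      using s \<epsilon> by (intro exI[of _ "ball s \<epsilon> \<inter> {0..}"]) (auto simp: openin_open)
  qed
  moreover have "connectedin (top_of_set {0..}) {0::real..}"
    by (simp add: connectedin_subtopology)
  ultimately have "connectedin limit.mtopology (ray ` {0..})"
    by (rule connectedin_continuous_map_image)
  then have "connectedin limit.mtopology (limit.mtopology closure_of (ray ` {0..}))"
    by (rule connectedin_closure_of)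
  moreover have "limit.mtopology closure_of (ray ` {0..}) = lollipop_limit"
    unfolding limit.metric_closure_of_alt
  proof (intro equalityI subsetI CollectI conjI allI impI)
    fix x and r :: real
    assume x: "x \<in> lollipop_limit" and "r > 0"
    obtain N where N: "seq_dist ldist x (ray (2 ^ N * x N)) \<le> r" using ray_dense[OF x \<open>r > 0\<close>] .
    have "0 \<le> 2 ^ N * x N" using lollipop_limit_in[OF x, of N] by simp
    then show "\<exists>y\<in>ray ` {0..}. y \<in> limit.mcball x r"
      using N x by (intro bexI[of _ "ray (2 ^ N * x N)"]) (auto simp: ray_in)
  qed auto
  ultimately show ?thesis by (simp add: connectedin_def)
qed

lemma ray_at_0 [simp]: "ray t 0 = t" if "0 \<le> t" "t < 2"
  using that by (simp add: ray_def wrap_id)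

lemma limit_no_isolated_points:
  assumes "x \<in> lollipop_limit"
  shows "\<not> openin limit.mtopology {x}"
proof
  assume "openin limit.mtopology {x}"
  moreover have "closedin limit.mtopology {x}"
    using assms by (simp add: closedin_Hausdorff_singleton limit.Hausdorff_space_mtopology)
  \<comment> \<open>A clopen point would be the whole connected space, but the ray has points with
    different first coordinates.\<close>
  ultimately have "{x} = lollipop_limit"
    using connected_space_limit unfolding connected_space_clopen_in by fastforce
  then have "ray 0 = ray 1" using ray_in[of 0] ray_in[of 1] by (metis singletonD zero_le_one order_refl)
  then show False using ray_at_0[of 0] ray_at_0[of 1] by simp
qed

section \<open>Failure of local connectedness\<close>

lemma ldist_double_near_periodic:
  assumes "\<bar>c - 3 / 2\<bar> = 1 / 6" "u \<in> {0..<2}" "ldist c u < 1 / 6"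
  shows "ldist (double c) (double u) = 2 * ldist c u"
proof -
  have c: "0 \<le> c" using assms(1) by linarith
  \<comment> \<open>Here \<open>c\<close> is 4/3 or 5/3, at least 1/3 away from both 1 and 2, so a
    distance below 1/6 cannot come from a route through the vertex.\<close>
  have "ldist c u = \<bar>c - u\<bar>"
    using assms by (cases c u rule: ldist_cases) auto
  then show ?thesis
    using assms(2,3) ldist_wrap_eq[of "2 * c" "2 * u"] c by (simp add: double_def abs_diff_2)
qed

text \<open>Close to the point of period two, a connected set cannot leave a sheet of the doubling map,
  whereas points of the ray close to it do.\<close>

lemma connectedin_stays_close:
  assumes q: "q \<in> lollipop_limit" and q': "\<And>n. \<bar>q n - 3 / 2\<bar> = 1 / 6"
    and C: "connectedin limit.mtopology C" "q \<in> C" "\<And>y. y \<in> C \<Longrightarrow> ldist (q 0) (y 0) < 1 / 6"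
  shows "y \<in> C \<Longrightarrow> ldist (q n) (y n) < 1 / 6"
proof (induction n arbitrary: y)
  case 0
  then show ?case by (rule C(3))
next
  case (Suc n)
  have CX: "C \<subseteq> lollipop_limit" using connectedin_subset_topspace[OF C(1)] by simp
  let ?g = "\<lambda>y. ldist (q (Suc n)) (y (Suc n))"
  \<comment> \<open>A distance in the interval from 1/12 to 1/6 would double to at least 1/6 one
    level below, against the induction hypothesis. The connected set, containing \<open>q\<close> at
    distance 0, cannot jump this gap.\<close>
  have gap: "?g y < 1 / 12 \<or> 1 / 6 \<le> ?g y" if "y \<in> C" for y
  proof (rule ccontr)
    assume *: "\<not> ?thesis"
    then have "ldist (double (q (Suc n))) (double (y (Suc n))) = 2 * ?g y"
      using lollipop_limit_in[of y] that CX by (intro ldist_double_near_periodic q') auto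
    moreover have "ldist (q n) (y n) < 1 / 6" using Suc.IH that .
    ultimately show False
      using * lollipop_limit_double[OF q] lollipop_limit_double[of y] that CX by auto
  qed
  have cont: "continuous_map limit.mtopology euclideanreal ?g"
    unfolding mtopology_is_euclidean[symmetric]
    unfolding Met_TC.continuous_map_to_metric
  proof (intro ballI allI impI)
    fix y and \<epsilon> :: real
    assume y: "y \<in> topspace limit.mtopology" and \<epsilon>: "\<epsilon> > 0"
    let ?U = "limit.mball y (\<epsilon> / 2 ^ Suc n)"
    have "?g z \<in> Met_TC.mball (?g y) \<epsilon>" if "z \<in> ?U" for z
    proof -
      have "ldist (y (Suc n)) (z (Suc n)) < \<epsilon>"
        using lollipop.seq_dist_lt_imp[of y z "\<epsilon> / 2 ^ Suc n" "Suc n"] that by simp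
      then show ?thesis
        using ldist_triangle[of "q (Suc n)" "z (Suc n)" "y (Suc n)"]
          ldist_triangle[of "q (Suc n)" "y (Suc n)" "z (Suc n)"]
          ldist_commute[of "z (Suc n)" "y (Suc n)"] by (simp add: dist_real_def abs_less_iff)
    qed
    then show "\<exists>U. openin limit.mtopology U \<and> y \<in> U \<and> (\<forall>z\<in>U. ?g z \<in> Met_TC.mball (?g y) \<epsilon>)"
      using y \<epsilon> by (intro exI[of _ ?U]) auto
  qed
  have "connected (?g ` C)"
    using connectedin_continuous_map_image[OF cont C(1)] by simp
  moreover have "0 \<in> ?g ` C"
    using C(2) lollipop_limit_in[OF q] by (auto simp: image_iff intro!: bexI[of _ q])
  ultimately have "1 / 12 \<in> ?g ` C" if "1 / 6 \<le> ?g y"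
    using that Suc.prems connectedD_interval[of "?g ` C" 0 "?g y" "1 / 12"] by auto
  then show ?case using gap[of y] gap Suc.prems by force
qed

lemma limit_not_locally_connected: "\<not> locally_connected_space limit.mtopology"
proof
  \<comment> \<open>The orbit of period two of \<open>double\<close>: 4/3 and 5/3 are
    exchanged.\<close>
  define q :: "nat \<Rightarrow> real" where "q n = (if even n then 4 / 3 else 5 / 3)" for n
  have fr: "frac (10 / 3 :: real) = 1 / 3" "frac (8 / 3 :: real) = 2 / 3"
    by (simp_all add: frac_def)
  have q: "q \<in> lollipop_limit"
    by (auto simp: lollipop_limit_def q_def double_def wrap_def fr)
  have q': "\<bar>q n - 3 / 2\<bar> = 1 / 6" for n by (simp add: q_def)
  assume "locally_connected_space limit.mtopology"
  then obtain C where C: "openin limit.mtopology C" "connectedin limit.mtopology C" "q \<in> C"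
    "C \<subseteq> limit.mball q (1 / 6)"
    unfolding locally_connected_space
    using limit.openin_mball[of q "1 / 6"] limit.centre_in_mball_iff[of q "1 / 6"] q
    by (metis divide_pos_pos zero_less_numeral zero_less_one)
  then obtain r where r: "r > 0" "limit.mcball q r \<subseteq> C"
    unfolding limit.openin_mtopology_mcball by blast
  obtain N where N: "seq_dist ldist q (ray (2 ^ N * q N)) \<le> r" using ray_dense[OF q r(1)] .
  \<comment> \<open>This ray point agrees with \<open>q\<close> up to level \<open>N\<close>, but
    its further preimages are halvings that fall onto the stem, while those of \<open>q\<close> stay
    on the circle. Going up two levels restores the parity of \<open>q\<close>.\<close>
  define y where "y = ray (2 ^ N * q N)"
  have "0 \<le> q N" by (simp add: q_def)
  then have "y \<in> C"
    using N q r(2) by (auto simp: y_def ray_in)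
  have "ldist (q 0) (z 0) < 1 / 6" if "z \<in> C" for z
    using lollipop.seq_dist_lt_imp[of q z "1 / 6" 0] C(4) that by auto
  then have "ldist (q (N + 2)) (y (N + 2)) < 1 / 6"
    using \<open>y \<in> C\<close> by (rule connectedin_stays_close[OF q q' C(2,3)])
  moreover have "y (N + 2) = q N / 4"
    using \<open>0 \<le> q N\<close> by (simp add: y_def ray_def power_add) (simp add: q_def wrap_id)
  moreover have "q (N + 2) = q N" by (simp add: q_def)
  ultimately have "ldist (q N) (q N / 4) < 1 / 6" by metis
  moreover have "4 / 3 \<le> q N" "q N \<le> 5 / 3" by (simp_all add: q_def)
  ultimately show False by (cases "q N" "q N / 4" rule: ldist_cases) simp_all
qed

section \<open>Expansivity\<close>

lemma Lipschitz_shift: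
  "Lipschitz_continuous_map (metric (lollipop_limit, seq_dist ldist))
     (metric (lollipop_limit, seq_dist ldist)) shift"
  unfolding Lipschitz_continuous_map_def
  using shift_in seq_dist_shift_le by (auto intro!: exI[of _ 2])

lemma Lipschitz_unshift:
  "Lipschitz_continuous_map (metric (lollipop_limit, seq_dist ldist))
     (metric (lollipop_limit, seq_dist ldist)) unshift"
  unfolding Lipschitz_continuous_map_def
  using unshift_in seq_dist_unshift_le by (auto intro!: exI[of _ 2])

lemma homeomorphic_map_shift: "homeomorphic_map limit.mtopology limit.mtopology shift"
proof -
  have "homeomorphic_maps limit.mtopology limit.mtopology shift unshift"
    using Lipschitz_continuous_imp_continuous_map[OF Lipschitz_shift]
      Lipschitz_continuous_imp_continuous_map[OF Lipschitz_unshift]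
    by (simp add: homeomorphic_maps_def mtopology_of_def unshift_shift)
  then show ?thesis by (rule homeomorphic_maps_imp_map)
qed

definition orbit :: "(nat \<Rightarrow> real) \<Rightarrow> int \<Rightarrow> nat \<Rightarrow> real" where
  "orbit x n = int_iterate lollipop_limit shift n x"

lemma orbit_in: "x \<in> lollipop_limit \<Longrightarrow> orbit x n \<in> lollipop_limit"
proof -
  assume x: "x \<in> lollipop_limit"
  have "(shift ^^ m) x \<in> lollipop_limit" for m
    using x by (induction m) (auto simp: shift_in)
  moreover have "(inv_into lollipop_limit shift ^^ m) x \<in> lollipop_limit" for m
    using x by (induction m) (auto simp: unshift_in inv_into_shift)
  ultimately show ?thesis by (simp add: orbit_def int_iterate_def)
qed

lemma orbit_Suc: "orbit x (n + 1) = shift (orbit x n)" if x: "x \<in> lollipop_limit"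
proof (cases "0 \<le> n")
  case True
  then have "nat (n + 1) = Suc (nat n)" by simp
  then show ?thesis using True by (simp add: orbit_def int_iterate_def)
next
  case False
  then obtain m where n: "n = - int (Suc m)" by (cases n rule: int_cases) auto
  then have m: "nat (- n) = Suc m" "nat (- (n + 1)) = m" by simp_all
  let ?z = "(inv_into lollipop_limit shift ^^ m) x"
  have z: "?z \<in> lollipop_limit"
    using x by (induction m) (auto simp: unshift_in inv_into_shift)
  have "orbit x n = unshift ?z"
    using False m(1) z by (simp add: orbit_def int_iterate_def inv_into_shift)
  \<comment> \<open>For \<open>m = 0\<close> the index \<open>n + 1\<close> is 0 and falls into the
    nonnegative branch of \<open>int_iterate\<close>; both branches then give
    \<open>x\<close>.\<close>
  moreover have "orbit x (n + 1) = ?z"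
    using False m(2) by (auto simp: orbit_def int_iterate_def not_le)
  ultimately show ?thesis by simp
qed

lemma orbit_pred: "orbit x (n - 1) = unshift (orbit x n)" if "x \<in> lollipop_limit"
  using orbit_Suc[OF that, of "n - 1"] orbit_in[OF that, of "n - 1"] unshift_shift by simp

lemma expansive_shift: "expansive_homeomorphism lollipop_limit (seq_dist ldist) shift"
  unfolding expansive_homeomorphism_def orbit_def[symmetric]
proof (intro conjI homeomorphic_map_shift exI[of _ "1 / 16"] ballI impI)
  fix x y assume xy: "x \<in> lollipop_limit" "y \<in> lollipop_limit" "x \<noteq> y"
  let ?D = "\<lambda>n. seq_dist ldist (orbit x n) (orbit y n)"
  show "\<exists>n. 1 / 16 < ?D n"
  proof (rule ccontr)
    assume "\<nexists>n. 1 / 16 < ?D n"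
    then have small: "?D n \<le> 1 / 16" for n by (meson not_le)
    \<comment> \<open>Since 1/16 lies below the threshold 1/8, the minimum in the hyperbolicity
      inequality must be its first entry, so one of the two neighbouring times doubles the distance.
      Repeating this contradicts boundedness.\<close>
    have step: "\<exists>m. ?D m \<ge> 2 * ?D n" for n
    proof -
      have "min (2 * ?D n) (1 / 8) \<le> max (?D (n + 1)) (?D (n - 1))"
        using seq_dist_hyperbolic[of "orbit x n" "orbit y n"] xy
        by (simp add: orbit_in orbit_Suc orbit_pred)
      then have "2 * ?D n \<le> ?D (n + 1) \<or> 2 * ?D n \<le> ?D (n - 1)"
        using small[of "n + 1"] small[of "n - 1"] by linarith
      then show ?thesis by blast
    qed
    have "\<exists>m. ?D m \<ge> 2 ^ k * ?D 0" for k
    proof (induction k)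
      case (Suc k)
      then obtain m where m: "?D m \<ge> 2 ^ k * ?D 0" ..
      obtain m' where "?D m' \<ge> 2 * ?D m" using step ..
      then show ?case using m by (intro exI[of _ m']) simp
    qed auto
    then have "2 ^ k * ?D 0 \<le> 1 / 16" for k using small order_trans by blast
    moreover have "?D 0 > 0"
      using xy limit.zero[of x y] limit.nonneg[of x y]
      by (simp add: orbit_def int_iterate_def less_le del: limit.zero limit.nonneg)
    moreover obtain k where "1 / 16 / ?D 0 < 2 ^ k" using real_arch_pow[of 2] by auto
    ultimately show False by (simp add: field_simps) (meson not_le)
  qed
qed simp

section \<open>Exponents at the end of the ray\<close>

text \<open>A point of the stem below the vertex has its half as only preimage under
  \<open>double\<close>, so the first coordinate determines all the others.\<close>

lemma limit_close_to_end:
  assumes y: "y \<in> lollipop_limit" and "seq_dist ldist (\<lambda>_. 0) y < 1"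
  shows "y n = y 0 / 2 ^ n" "y 0 < 1"
proof -
  have "ldist 0 (y 0) < 1" using lollipop.seq_dist_lt_imp[OF assms(2), of 0] by simp
  then show y0: "y 0 < 1"
    using lollipop_limit_in[OF y, of 0] by (cases "0::real" "y 0" rule: ldist_cases) auto
  have "y n = y 0 / 2 ^ n \<and> y n < 1"
  proof (induction n)
    case (Suc n)
    have "wrap (2 * y (Suc n)) < 1"
      using Suc lollipop_limit_double[OF y, of n] by (metis double_def)
    then have "2 * y (Suc n) < 1"
      by (rule contrapos_pp) (simp add: wrap_def not_less)
    then show ?case
      using Suc lollipop_limit_double[OF y, of n] by (auto simp: double_def wrap_def)
  qed (use y0 in simp)
  then show "y n = y 0 / 2 ^ n" ..
qed

lemma divide_power_2_le: "c / 2 ^ n \<le> c" if "0 \<le> c" for c :: real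
  using that divide_left_mono[of 1 "2 ^ n" c] by simp

text \<open>The supremum is attained at coordinate 0, since both the coordinates and their weights
  decrease.\<close>

lemma seq_dist_end: "seq_dist ldist (\<lambda>_. 0) (\<lambda>n. c / 2 ^ n) = c" if "0 \<le> c" "c \<le> 1"
proof (rule antisym)
  have ld: "ldist 0 s = s" if "0 \<le> s" "s \<le> 1" for s
    using that by (intro ldist_eqI) auto
  have le: "c / 2 ^ n \<le> c" for n :: nat
    using that(1) by (rule divide_power_2_le)
  show "seq_dist ldist (\<lambda>_. 0) (\<lambda>n. c / 2 ^ n) \<le> c"
  proof (rule lollipop.seq_dist_le)
    fix n
    have "ldist 0 (c / 2 ^ n) = c / 2 ^ n"
      using order_trans[OF le that(2)] that(1) by (intro ld) simp_all
    then show "ldist 0 (c / 2 ^ n) / 2 ^ n \<le> c"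
      using divide_power_2_le[of "c / 2 ^ n" n] le[of n] that(1) by simp
  qed
  show "c \<le> seq_dist ldist (\<lambda>_. 0) (\<lambda>n. c / 2 ^ n)"
    using lollipop.dist_le_seq_dist[of "\<lambda>_. 0" 0 "\<lambda>n. c / 2 ^ n"] ld[OF that] by simp
qed

lemma max_expansion_end:
  assumes \<delta>: "0 < \<delta>" "\<delta> < 1"
  shows "max_expansion lollipop_limit (seq_dist ldist) shift \<delta> (\<lambda>_. 0) n = 1 / 2 ^ n"
proof -
  let ?p = "\<lambda>_::nat. 0::real" and ?D = "seq_dist ldist"
  let ?B = "punctured_dyn_ball lollipop_limit ?D shift \<delta> ?p n"
  have orbit_dist: "?D ((shift ^^ j) ?p) ((shift ^^ j) (\<lambda>n. c / 2 ^ n)) = c / 2 ^ j"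
    if "0 \<le> c" "c \<le> 1" for c j
  proof -
    have "c / 2 ^ j \<le> 1" using divide_power_2_le[OF that(1)] that(2) by (rule order_trans)
    with that(1) have "?D ?p (\<lambda>n. c / 2 ^ j / 2 ^ n) = c / 2 ^ j"
      by (intro seq_dist_end) simp_all
    then show ?thesis by (simp add: shift_funpow power_add mult.commute)
  qed
  have quot: "?D ((shift ^^ n) ?p) ((shift ^^ n) y) / ?D ?p y = 1 / 2 ^ n" if "y \<in> ?B" for y
  proof -
    have y: "y \<in> lollipop_limit" "y \<noteq> ?p" "?D ?p y \<le> \<delta>"
      using that by (auto simp: punctured_dyn_ball_def)
    define c where "c = y 0"
    have "?D ?p y < 1" using y(3) \<delta>(2) by (rule le_less_trans)
    note close = limit_close_to_end[OF y(1) this]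
    have yc: "y = (\<lambda>n. c / 2 ^ n)" unfolding c_def by (intro ext close(1))
    have "c < 1" unfolding c_def by (rule close(2))
    have "0 \<le> c" using lollipop_limit_in[OF y(1), of 0] by (simp add: c_def)
    moreover have "c \<noteq> 0" using y(2) yc by auto
    moreover have "?D ?p y = c"
      unfolding yc using \<open>0 \<le> c\<close> \<open>c < 1\<close> by (intro seq_dist_end) simp_all
    moreover have "?D ((shift ^^ n) ?p) ((shift ^^ n) y) = c / 2 ^ n"
      unfolding yc using \<open>0 \<le> c\<close> \<open>c < 1\<close> by (intro orbit_dist) simp_all
    ultimately show ?thesis by simp
  qed
  \<comment> \<open>This point shows that the ball is nonempty, so the supremum of the constant
    quotient is that constant.\<close>
  have "ray \<delta> = (\<lambda>n. \<delta> / 2 ^ n)"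
  proof
    fix n
    have "\<delta> / 2 ^ n \<le> \<delta>" using \<delta> by (intro divide_power_2_le) simp
    then show "ray \<delta> n = \<delta> / 2 ^ n" using \<delta> by (simp add: ray_def wrap_id)
  qed
  then have "ray \<delta> \<in> ?B"
    unfolding punctured_dyn_ball_def
    using \<delta> ray_in[of \<delta>] orbit_dist[of \<delta>] divide_power_2_le[of \<delta>]
    by (auto dest: fun_cong[of _ _ 0])
  then show ?thesis
    unfolding max_expansion_def using quot by (intro cSup_eq_maximum) force+
qed

lemma upper_lyapunov_exponent_end:
  "upper_lyapunov_exponent lollipop_limit (seq_dist ldist) shift (\<lambda>_. 0) = ereal (- ln 2)"
proof -
  have "upper_exponent_scale lollipop_limit (seq_dist ldist) shift \<delta> (\<lambda>_. 0) = ereal (- ln 2)"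
    if "0 < \<delta>" "\<delta> < 1" for \<delta>
  proof -
    \<comment> \<open>The index 0 is left out: there \<open>1 / real n\<close> is 0 by convention
      and the term would vanish.\<close>
    have "\<forall>\<^sub>F n in sequentially. ereal (1 / real n *
        ln (max_expansion lollipop_limit (seq_dist ldist) shift \<delta> (\<lambda>_. 0) n)) = ereal (- ln 2)"
      using eventually_gt_at_top[of 0]
      by eventually_elim (simp add: max_expansion_end that ln_div ln_realpow)
    from Limsup_eq[OF this] show ?thesis
      by (simp only: upper_exponent_scale_def Limsup_const trivial_limit_sequentially
          not_False_eq_True)
  qed
  then have "\<forall>\<^sub>F \<delta> in at_right 0.
      upper_exponent_scale lollipop_limit (seq_dist ldist) shift \<delta> (\<lambda>_. 0) = ereal (- ln 2)"
    using eventually_at_right_real[of 0 1] by (auto elim: eventually_mono)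
  then show ?thesis
    unfolding upper_lyapunov_exponent_def
    by (intro tendsto_Lim tendsto_eventually) auto
qed

theorem theorem2p7:
  shows "\<exists>(X :: (nat \<Rightarrow> real) set) dist_X f d k \<epsilon>\<^sub>0.
    Metric_space X dist_X \<and>
    compact_space (Metric_space.mtopology X dist_X) \<and>
    connected_space (Metric_space.mtopology X dist_X) \<and>
    (\<forall>x\<in>X. \<not> openin (Metric_space.mtopology X dist_X) {x}) \<and>
    \<not> locally_connected_space (Metric_space.mtopology X dist_X) \<and>
    expansive_homeomorphism X dist_X f \<and>
    Metric_space X d \<and>
    Metric_space.mtopology X d = Metric_space.mtopology X dist_X \<and>
    k > 1 \<and> \<epsilon>\<^sub>0 > 0 \<and>
    Lipschitz_continuous_map (metric (X, d)) (metric (X, d)) f \<and>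
    Lipschitz_continuous_map (metric (X, d)) (metric (X, d)) (inv_into X f) \<and>
    (\<forall>x\<in>X. \<forall>y\<in>X.
      max (d (f x) (f y)) (d (inv_into X f x) (inv_into X f y)) \<ge> min (k * d x y) \<epsilon>\<^sub>0) \<and>
    (\<exists>x\<in>X. \<not> (upper_lyapunov_exponent X d f x \<ge> ereal (ln k) \<and>
                lower_lyapunov_exponent X d f x \<le> ereal (- ln k)))"
proof (rule exI[of _ lollipop_limit], rule exI[of _ "seq_dist ldist"], rule exI[of _ shift],
    rule exI[of _ "seq_dist ldist"], rule exI[of _ 2], rule exI[of _ "1 / 8"], intro conjI)
  show "(2::real) > 1" "(1 / 8 :: real) > 0" by simp_all
  show "Lipschitz_continuous_map (metric (lollipop_limit, seq_dist ldist))
      (metric (lollipop_limit, seq_dist ldist)) (inv_into lollipop_limit shift)"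
    using Lipschitz_continuous_map_eq[OF Lipschitz_unshift] by (simp add: inv_into_shift)
  show "\<forall>x\<in>lollipop_limit. \<forall>y\<in>lollipop_limit.
      min (2 * seq_dist ldist x y) (1 / 8)
      \<le> max (seq_dist ldist (shift x) (shift y))
          (seq_dist ldist (inv_into lollipop_limit shift x) (inv_into lollipop_limit shift y))"
    using seq_dist_hyperbolic by (simp add: inv_into_shift)
  \<comment> \<open>At the end of the ray the upper exponent is \<open>- ln 2\<close>, below
    \<open>ln 2\<close>; this refutes the first conjunct, whatever the lower exponent is.\<close>
  have "(\<lambda>_. 0) \<in> lollipop_limit" using ray_in[of 0] by (simp add: ray_def wrap_def)
  then show "\<exists>x\<in>lollipop_limit.
      \<not> (ereal (ln 2) \<le> upper_lyapunov_exponent lollipop_limit (seq_dist ldist) shift x \<and>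
         lower_lyapunov_exponent lollipop_limit (seq_dist ldist) shift x \<le> ereal (- ln 2))"
    by (intro bexI[of _ "\<lambda>_. 0"]) (simp_all add: upper_lyapunov_exponent_end)
qed (simp_all add: compact_space_limit connected_space_limit limit_no_isolated_points
    limit_not_locally_connected expansive_shift Lipschitz_shift limit.Metric_space_axioms)

end
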